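(* Let $G$ be a finite group and let $A$ be a $\mathbb{Q}$-Green functor for $G$. Suppose $\mathscr{C}$ is a set of subgroups of $G$ closed under conjugation such that $\mathscr{C}$ contains the centralizer $C_G(K)$ of every primordial subgroup $K$ of $A$. Then $$\mathbb{1}_G=\sum_{H\in\mathscr{C}}\frac{-\widetilde{\chi}(\mathscr{C}_{<H})}{|G:C_G(H)|}\,\mathrm{ind}_{C_G(H)}^{G}(\mathbb{1}_{C_G(H)})$$ in $A(G)$.
   Context: A $\mathbb{Q}$-Green functor $A$ for $G$ assigns to each subgroup $H\le G$ an associative $\mathbb{Q}$-algebra $A(H)$ with identity $\mathbb{1}_H$, and $\mathbb{Q}$-linear maps $\mathrm{res}_H^K:A(K)\to A(H)$, $\mathrm{ind}_H^K:A(H)\to A(K)$ for $H\le K\le G$ and $c_g:A(H)\to A({}^gH)$ for $g\in G$ (where ${}^gH=gHg^{-1}$), satisfying the usual axioms: $\mathrm{res}$ and $\mathrm{ind}$ are transitive, with $\mathrm{res}_H^H=\mathrm{ind}_H^H=\mathrm{id}$; $c_gc_{g'}=c_{gg'}$, and $c_h$ is the identity on $A(H)$ for $h\in H$; $c_g$ commutes with $\mathrm{res}$ and $\mathrm{ind}$; the Mackey formula $\mathrm{res}^K_L\,\mathrm{ind}_H^K=\sum_{g\in[L\backslash K/H]}\mathrm{ind}_{L\cap{}^gH}^L\,\mathrm{res}^{{}^gH}_{L\cap{}^gH}\,c_g$ for $L,H\le K$; $\mathrm{res}$ and $c_g$ are unital algebra homomorphisms; and Frobenius reciprocity $\mathrm{ind}_H^K(a)\,b=\mathrm{ind}_H^K(a\,\mathrm{res}_H^K(b))$,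 $b\,\mathrm{ind}_H^K(a)=\mathrm{ind}_H^K(\mathrm{res}_H^K(b)\,a)$. A subgroup $H\le G$ is a primordial subgroup of $A$ if the map $\bigoplus_{K<H}\mathrm{ind}_K^H:\bigoplus_{K<H}A(K)\to A(H)$ (sum over proper subgroups $K$ of $H$) is not surjective. $\mathscr{C}_{<H}$ is the poset of members of $\mathscr{C}$ properly contained in $H$; $\widetilde{\chi}=\chi-1$ is the reduced Euler characteristic of (the order complex of) a finite poset, with $\widetilde{\chi}(\emptyset)=-1$. *)

theory Defs
  imports "HOL-Algebra.Algebra" "HOL-Algebra.Algebraic_Closure_Type"
begin

definition order_complex :: "'a::order set \<Rightarrow> 'a set set"
  where "order_complex P = {s. s \<subseteq> P \<and> finite s \<and> s \<noteq> {} \<and> Complete_Partial_Order.chain (\<le>) s}"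

definition euler_characteristic :: "'a::order set \<Rightarrow> int"
  where "euler_characteristic P = (\<Sum>s\<in>order_complex P. (- 1) ^ (card s - 1))"

definition reduced_euler_characteristic :: "'a::order set \<Rightarrow> int"
  where "reduced_euler_characteristic P = euler_characteristic P - 1"

definition centralizer :: "('g, 'm) monoid_scheme \<Rightarrow> 'g set \<Rightarrow> 'g set"
  where "centralizer G H = {g \<in> carrier G. \<forall>h\<in>H. g \<otimes>\<^bsub>G\<^esub> h = h \<otimes>\<^bsub>G\<^esub> g}"

abbreviation conjugate :: "('g, 'm) monoid_scheme \<Rightarrow> 'g \<Rightarrow> 'g set \<Rightarrow> 'g set"
  where "conjugate G g H \<equiv> g <#\<^bsub>G\<^esub> H #>\<^bsub>G\<^esub> (inv\<^bsub>G\<^esub> g)"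

text \<open>\<open>R\<close> is a system of representatives \<open>[L\K/H]\<close> of the double cosets of \<open>L\<close> and \<open>H\<close> in \<open>K\<close>.\<close>

definition double_coset_reps ::
    "('g, 'm) monoid_scheme \<Rightarrow> 'g set \<Rightarrow> 'g set \<Rightarrow> 'g set \<Rightarrow> 'g set \<Rightarrow> bool"
  where "double_coset_reps G L K H R \<longleftrightarrow>
    R \<subseteq> K \<and> (\<forall>x\<in>K. \<exists>!g. g \<in> R \<and> x \<in> (L #>\<^bsub>G\<^esub> g) <#>\<^bsub>G\<^esub> H)"

text \<open>The locale \<open>algebra\<close> of the library covers commutative algebras only.\<close>

locale associative_algebra = module R M + M: ring M for R (structure) and M (structure) +
  assumes smult_mult_left:
      "\<lbrakk>a \<in> carrier R; x \<in> carrier M; y \<in> carrier M\<rbrakk> \<Longrightarrow>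
        (a \<odot>\<^bsub>M\<^esub> x) \<otimes>\<^bsub>M\<^esub> y = a \<odot>\<^bsub>M\<^esub> (x \<otimes>\<^bsub>M\<^esub> y)"
    and smult_mult_right:
      "\<lbrakk>a \<in> carrier R; x \<in> carrier M; y \<in> carrier M\<rbrakk> \<Longrightarrow>
        x \<otimes>\<^bsub>M\<^esub> (a \<odot>\<^bsub>M\<^esub> y) = a \<odot>\<^bsub>M\<^esub> (x \<otimes>\<^bsub>M\<^esub> y)"

definition linear_maps ::
    "('r, 'k) ring_scheme \<Rightarrow> ('r, 'a, 'm) module_scheme \<Rightarrow> ('r, 'b, 'n) module_scheme \<Rightarrow> ('a \<Rightarrow> 'b) set"
  where "linear_maps R M N = {f \<in> carrier M \<rightarrow> carrier N.
    (\<forall>x\<in>carrier M. \<forall>y\<in>carrier M. f (x \<oplus>\<^bsub>M\<^esub> y) = f x \<oplus>\<^bsub>N\<^esub> f y) \<and>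
    (\<forall>a\<in>carrier R. \<forall>x\<in>carrier M. f (a \<odot>\<^bsub>M\<^esub> x) = a \<odot>\<^bsub>N\<^esub> f x)}"

abbreviation rat_field :: "rat ring"
  where "rat_field \<equiv> ring_of_type_algebra"

text \<open>
  The subgroup arguments of the structure maps are ordered from source to target:
  \<open>res K H\<close> maps \<open>A K\<close> to \<open>A H\<close> and \<open>ind H K\<close> maps \<open>A H\<close> to \<open>A K\<close>, for \<open>H \<subseteq> K\<close>,
  and \<open>cj g H\<close> is conjugation by \<open>g\<close> with source \<open>A H\<close>.
  The algebras \<open>A H\<close> are carriers in one common type; values of \<open>A\<close> and of the maps
  outside subgroups and carriers are unconstrained.
\<close>

locale rational_green_functor = group G for G :: "('g, 'm) monoid_scheme" (structure) +
  fixes A :: "'g set \<Rightarrow> (rat, 'a) module"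
    and res :: "'g set \<Rightarrow> 'g set \<Rightarrow> 'a \<Rightarrow> 'a"
    and ind :: "'g set \<Rightarrow> 'g set \<Rightarrow> 'a \<Rightarrow> 'a"
    and cj :: "'g \<Rightarrow> 'g set \<Rightarrow> 'a \<Rightarrow> 'a"
  assumes finite_carrier: "finite (carrier G)"
    and algebra: "subgroup H G \<Longrightarrow> associative_algebra rat_field (A H)"
    and res_linear: "\<lbrakk>subgroup H G; subgroup K G; H \<subseteq> K\<rbrakk> \<Longrightarrow>
      res K H \<in> linear_maps rat_field (A K) (A H)"
    and ind_linear: "\<lbrakk>subgroup H G; subgroup K G; H \<subseteq> K\<rbrakk> \<Longrightarrow>
      ind H K \<in> linear_maps rat_field (A H) (A K)"
    and cj_linear: "\<lbrakk>subgroup H G; g \<in> carrier G\<rbrakk> \<Longrightarrow>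
      cj g H \<in> linear_maps rat_field (A H) (A (conjugate G g H))"
    and res_ring_hom: "\<lbrakk>subgroup H G; subgroup K G; H \<subseteq> K\<rbrakk> \<Longrightarrow>
      res K H \<in> ring_hom (A K) (A H)"
    and cj_ring_hom: "\<lbrakk>subgroup H G; g \<in> carrier G\<rbrakk> \<Longrightarrow>
      cj g H \<in> ring_hom (A H) (A (conjugate G g H))"
    and res_trans: "\<lbrakk>subgroup H G; subgroup K G; subgroup L G; H \<subseteq> K; K \<subseteq> L; x \<in> carrier (A L)\<rbrakk> \<Longrightarrow>
      res K H (res L K x) = res L H x"
    and ind_trans: "\<lbrakk>subgroup H G; subgroup K G; subgroup L G; H \<subseteq> K; K \<subseteq> L; x \<in> carrier (A H)\<rbrakk> \<Longrightarrow>
      ind K L (ind H K x) = ind H L x"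
    and res_id: "\<lbrakk>subgroup H G; x \<in> carrier (A H)\<rbrakk> \<Longrightarrow> res H H x = x"
    and ind_id: "\<lbrakk>subgroup H G; x \<in> carrier (A H)\<rbrakk> \<Longrightarrow> ind H H x = x"
    and cj_cj: "\<lbrakk>subgroup H G; g \<in> carrier G; g' \<in> carrier G; x \<in> carrier (A H)\<rbrakk> \<Longrightarrow>
      cj g (conjugate G g' H) (cj g' H x) = cj (g \<otimes> g') H x"
    and cj_id: "\<lbrakk>subgroup H G; h \<in> H; x \<in> carrier (A H)\<rbrakk> \<Longrightarrow> cj h H x = x"
    and cj_res: "\<lbrakk>subgroup H G; subgroup K G; H \<subseteq> K; g \<in> carrier G; x \<in> carrier (A K)\<rbrakk> \<Longrightarrow>
      cj g H (res K H x) = res (conjugate G g K) (conjugate G g H) (cj g K x)"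
    and cj_ind: "\<lbrakk>subgroup H G; subgroup K G; H \<subseteq> K; g \<in> carrier G; x \<in> carrier (A H)\<rbrakk> \<Longrightarrow>
      cj g K (ind H K x) = ind (conjugate G g H) (conjugate G g K) (cj g H x)"
    and mackey: "\<lbrakk>subgroup H G; subgroup L G; subgroup K G; H \<subseteq> K; L \<subseteq> K;
        double_coset_reps G L K H R; x \<in> carrier (A H)\<rbrakk> \<Longrightarrow>
      res K L (ind H K x) =
        (\<Oplus>\<^bsub>A L\<^esub>g\<in>R. ind (L \<inter> conjugate G g H) L
          (res (conjugate G g H) (L \<inter> conjugate G g H) (cj g H x)))"
    and frobenius_left: "\<lbrakk>subgroup H G; subgroup K G; H \<subseteq> K; a \<in> carrier (A H); b \<in> carrier (A K)\<rbrakk> \<Longrightarrow>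
      ind H K a \<otimes>\<^bsub>A K\<^esub> b = ind H K (a \<otimes>\<^bsub>A H\<^esub> res K H b)"
    and frobenius_right: "\<lbrakk>subgroup H G; subgroup K G; H \<subseteq> K; a \<in> carrier (A H); b \<in> carrier (A K)\<rbrakk> \<Longrightarrow>
      b \<otimes>\<^bsub>A K\<^esub> ind H K a = ind H K (res K H b \<otimes>\<^bsub>A H\<^esub> a)"

text \<open>
  As there are finitely many proper subgroups \<open>K\<close> of \<open>H\<close>, the elements of the direct sum of
  the \<open>A K\<close> are all the families in \<open>\<Pi>\<^sub>E K. carrier (A K)\<close>.
\<close>

definition primordial ::
    "('g, 'm) monoid_scheme \<Rightarrow> ('g set \<Rightarrow> (rat, 'a) module) \<Rightarrow> ('g set \<Rightarrow> 'g set \<Rightarrow> 'a \<Rightarrow> 'a) \<Rightarrow>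
      'g set \<Rightarrow> bool"
  where "primordial G A ind H \<longleftrightarrow> subgroup H G \<and>
    (let \<P> = {K. subgroup K G \<and> K \<subset> H} in
      (\<lambda>a. \<Oplus>\<^bsub>A H\<^esub>K\<in>\<P>. ind K H (a K)) ` (\<Pi>\<^sub>E K\<in>\<P>. carrier (A K)) \<noteq> carrier (A H))"

end

theory Submission
  imports Defs
begin

text \<open>
  Let \<open>I K\<close> (\<open>proper_ind K\<close> below) be the ideal of \<open>A K\<close> generated by inductions from proper subgroups.
  By the Mackey formula, \<open>ind\<^bsub>H\<^esub>\<^bsup>G\<^esup> 1\<close> restricts to a scalar modulo \<open>I K\<close>, namely the number of
  \<open>K\<close>-fixed points on \<open>G/H\<close>; this replaces the mark homomorphisms of the Burnside ring.
  An element of \<open>I K\<close> all of whose proper restrictions vanish is zero, because some element of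
  \<open>1 + I K\<close> restricts to zero on every proper subgroup. Since \<open>A K = I K\<close> for non-primordial \<open>K\<close>,
  induction on \<open>K\<close> shows that \<open>x\<close> in \<open>A G\<close> equals \<open>1\<close> as soon as its scalar at every primordial \<open>K\<close> is \<open>1\<close>.
  For the right-hand side of the theorem, this scalar is the sum of \<open>- \<chi>\<close> (reduced, of \<open>\<C>\<close> below \<open>H\<close>)
  over all \<open>H\<close> in \<open>\<C>\<close> contained in the centralizer of \<open>K\<close>, which is the Euler characteristic of
  a poset with a largest element.
\<close>

subsection \<open>Euler characteristics of finite posets\<close>

text \<open>An order isomorphism carries chains to chains of the same cardinality, so it induces a
  bijection of order complexes that preserves every sign.\<close>

lemma euler_characteristic_iso:
  assumes "bij_betw f P Q" and mono: "\<And>x y. \<lbrakk>x \<in> P; y \<in> P\<rbrakk> \<Longrightarrow> f x \<le> f y \<longleftrightarrow> x \<le> y"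
  shows "euler_characteristic P = euler_characteristic Q"
proof -
  have inj: "inj_on f P" and im: "f ` P = Q"
    using assms(1) by (auto simp: bij_betw_def)
  have chain: "Complete_Partial_Order.chain (\<le>) (f ` s) \<longleftrightarrow> Complete_Partial_Order.chain (\<le>) s"
    if "s \<subseteq> P" for s
    using that mono by (simp add: chain_def subset_eq)
  have fin: "finite (f ` s) \<longleftrightarrow> finite s" if "s \<subseteq> P" for s
    using that inj finite_image_iff inj_on_subset by metis
  have "bij_betw ((`) f) (order_complex P) (order_complex Q)"
    unfolding bij_betw_def
  proof
    show "inj_on ((`) f) (order_complex P)"
      using inj by (auto intro!: inj_onI simp: order_complex_def inj_on_image_eq_iff)
    show "(`) f ` order_complex P = order_complex Q"
    proof (intro equalityI subsetI)
      fix t assume "t \<in> (`) f ` order_complex P"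
      then show "t \<in> order_complex Q"
        using chain im by (auto simp: order_complex_def)
    next
      fix t assume t: "t \<in> order_complex Q"
      then obtain s where s: "s \<subseteq> P" "t = f ` s"
        using im unfolding order_complex_def by (metis (no_types, lifting) mem_Collect_eq subset_imageE)
      then have "s \<in> order_complex P"
        using t chain[OF s(1)] fin[OF s(1)] by (auto simp: order_complex_def)
      with s show "t \<in> (`) f ` order_complex P" by blast
    qed
  qed
  then have "euler_characteristic Q = (\<Sum>s\<in>order_complex P. (- 1) ^ (card (f ` s) - 1))"
    unfolding euler_characteristic_def by (rule sum.reindex_bij_betw[symmetric])
  also have "\<dots> = euler_characteristic P"
    unfolding euler_characteristic_def
  proof (rule sum.cong)
    fix s assume "s \<in> order_complex P"
    then have "inj_on f s" using inj inj_on_subset by (auto simp: order_complex_def)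
    then show "(- 1 :: int) ^ (card (f ` s) - 1) = (- 1) ^ (card s - 1)"
      by (simp add: card_image)
  qed simp
  finally show ?thesis by simp
qed

text \<open>The chains are sorted by their largest element.\<close>

lemma euler_characteristic_eq_sum:
  fixes P :: "'a::order set"
  assumes "finite P"
  shows "euler_characteristic P = (\<Sum>x\<in>P. - reduced_euler_characteristic {y \<in> P. y < x})"
proof -
  define top where "top x = {s \<in> order_complex P. x \<in> s \<and> (\<forall>y\<in>s. y \<le> x)}" for x
  have fin: "finite (order_complex Q)" if "finite Q" for Q :: "'a set"
    using that by (auto simp: order_complex_def intro: finite_subset[of _ "Pow Q"])
  have "order_complex P \<subseteq> (\<Union>x\<in>P. top x)"
  proof
    fix s assume s: "s \<in> order_complex P"
    then obtain x where x: "x \<in> s" "\<And>y. y \<in> s \<Longrightarrow> x \<le> y \<Longrightarrow> x = y"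
      using finite_has_maximal[of s] by (auto simp: order_complex_def)
    then have "\<forall>y\<in>s. y \<le> x"
      using s by (metis (mono_tags, lifting) chain_def mem_Collect_eq order_complex_def order_refl)
    with s x(1) show "s \<in> (\<Union>x\<in>P. top x)"
      by (auto simp: top_def order_complex_def)
  qed
  then have union: "order_complex P = (\<Union>x\<in>P. top x)"
    by (auto simp: top_def)
  have "euler_characteristic P = (\<Sum>x\<in>P. \<Sum>s\<in>top x. (- 1) ^ (card s - 1))"
    unfolding euler_characteristic_def union
  proof (rule sum.UNION_disjoint)
    show "\<forall>x\<in>P. finite (top x)"
      using fin[OF assms] by (simp add: top_def)
    show "\<forall>x\<in>P. \<forall>y\<in>P. x \<noteq> y \<longrightarrow> top x \<inter> top y = {}"
      by (auto simp: top_def intro: order_antisym)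
  qed (rule assms)
  also have "\<dots> = (\<Sum>x\<in>P. - reduced_euler_characteristic {y \<in> P. y < x})"
  proof (rule sum.cong)
    fix x assume x: "x \<in> P"
    let ?Q = "{y \<in> P. y < x}"
    \<comment> \<open>One chain with largest element \<open>x\<close> is \<open>x\<close> alone;
      every other one is a nonempty chain strictly below \<open>x\<close> with \<open>x\<close>
      adjoined.\<close>
    have "top x = insert {x} (insert x ` order_complex ?Q)"
    proof (intro equalityI subsetI)
      fix s assume s: "s \<in> top x"
      show "s \<in> insert {x} (insert x ` order_complex ?Q)"
      proof (cases "s = {x}")
        case False
        with s have "s - {x} \<in> order_complex ?Q" and "s = insert x (s - {x})"
          by (auto simp: top_def order_complex_def chain_def order.strict_iff_order)
        then show ?thesis by blast
      qed simp
    next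
      fix s assume "s \<in> insert {x} (insert x ` order_complex ?Q)"
      then obtain t where t: "s = insert x t" "t = {} \<or> t \<in> order_complex ?Q" by blast
      then have t': "t \<subseteq> P" "finite t" "Complete_Partial_Order.chain (\<le>) t" "\<forall>y\<in>t. y \<le> x"
        using t(2) unfolding order_complex_def
        by (safe; simp add: chain_empty subset_eq order.strict_implies_order)+
      then have "Complete_Partial_Order.chain (\<le>) s"
        unfolding t(1) chain_def by simp
      with t(1) t' x show "s \<in> top x"
        by (simp add: top_def order_complex_def)
    qed
    then have "(\<Sum>s\<in>top x. (- 1 :: int) ^ (card s - 1))
        = (\<Sum>s\<in>insert {x} (insert x ` order_complex ?Q). (- 1) ^ (card s - 1))"
      by simp
    also have "\<dots> = 1 + (\<Sum>s\<in>insert x ` order_complex ?Q. (- 1) ^ (card s - 1))"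
      using fin[of ?Q] assms by (subst sum.insert) (auto simp: order_complex_def)
    also have "(\<Sum>s\<in>insert x ` order_complex ?Q. (- 1 :: int) ^ (card s - 1))
        = (\<Sum>s\<in>order_complex ?Q. (- 1) ^ (card (insert x s) - 1))"
    proof (rule sum.reindex_cong[of "insert x"])
      show "inj_on (insert x) (order_complex ?Q)"
      proof (rule inj_onI)
        fix s t assume "s \<in> order_complex ?Q" "t \<in> order_complex ?Q" "insert x s = insert x t"
        moreover from this have "x \<notin> s" "x \<notin> t" by (auto simp: order_complex_def)
        ultimately show "s = t" by (metis insert_ident)
      qed
    qed auto
    \<comment> \<open>Adjoining \<open>x\<close> raises the cardinality by one and flips the sign.
      The chains \<open>s\<close> are nonempty, so the truncated subtraction in the exponent is a
      genuine one.\<close>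
    also have "\<dots> = (\<Sum>s\<in>order_complex ?Q. - ((- 1) ^ (card s - 1)))"
    proof (rule sum.cong)
      fix s assume s: "s \<in> order_complex ?Q"
      then have "x \<notin> s" "finite s" "card s > 0" by (auto simp: order_complex_def card_gt_0_iff)
      then obtain n where "card s = Suc n" "card (insert x s) = Suc (Suc n)"
        using gr0_implies_Suc by (metis card_insert_disjoint)
      then show "(- 1 :: int) ^ (card (insert x s) - 1) = - ((- 1) ^ (card s - 1))"
        by simp
    qed simp
    finally show "(\<Sum>s\<in>top x. (- 1 :: int) ^ (card s - 1)) = - reduced_euler_characteristic ?Q"
      by (simp add: reduced_euler_characteristic_def euler_characteristic_def sum_negf)
  qed simp
  finally show ?thesis .
qed

text \<open>By \<open>euler_characteristic_eq_sum\<close> the elements below \<open>m\<close>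
  contribute the Euler characteristic of the poset below \<open>m\<close>, and \<open>m\<close>
  itself contributes one minus that number.\<close>

lemma sum_reduced_euler_characteristic_top:
  fixes P :: "'a::order set"
  assumes "finite P" "m \<in> P" "\<And>x. x \<in> P \<Longrightarrow> x \<le> m"
  shows "(\<Sum>x\<in>P. - reduced_euler_characteristic {y \<in> P. y < x}) = 1"
proof -
  let ?Q = "{y \<in> P. y < m}"
  have P: "P = insert m ?Q" using assms by (auto simp: order.strict_iff_order)
  \<comment> \<open>Removing \<open>m\<close> does not change which elements lie below a smaller
    \<open>x\<close>.\<close>
  have "(\<Sum>x\<in>?Q. - reduced_euler_characteristic {y \<in> P. y < x})
      = (\<Sum>x\<in>?Q. - reduced_euler_characteristic {y \<in> ?Q. y < x})"
  proof (rule sum.cong)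
    fix x assume "x \<in> ?Q"
    then have "{y \<in> P. y < x} = {y \<in> ?Q. y < x}" by auto
    then show "- reduced_euler_characteristic {y \<in> P. y < x}
        = - reduced_euler_characteristic {y \<in> ?Q. y < x}" by simp
  qed simp
  also have "\<dots> = euler_characteristic ?Q"
    using assms(1) by (simp add: euler_characteristic_eq_sum)
  finally have *: "(\<Sum>x\<in>?Q. - reduced_euler_characteristic {y \<in> P. y < x}) = euler_characteristic ?Q" .
  have "(\<Sum>x\<in>P. - reduced_euler_characteristic {y \<in> P. y < x})
      = - reduced_euler_characteristic ?Q + (\<Sum>x\<in>?Q. - reduced_euler_characteristic {y \<in> P. y < x})"
    using assms(1) by (subst (1) P, subst sum.insert) auto
  with * show ?thesis by (simp add: reduced_euler_characteristic_def)
qed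

subsection \<open>Conjugates, centralizers and double cosets\<close>

context group
begin

text \<open>Next to \<open>m_assoc\<close>, this and its mirror image cancel factors in right-nested
  products; together they normalize the conjugation words below.\<close>

lemma mult_inv_mult: "\<lbrakk>g \<in> carrier G; x \<in> carrier G\<rbrakk> \<Longrightarrow> g \<otimes> (inv g \<otimes> x) = x"
  by (simp flip: m_assoc)

lemma inv_mult_mult: "\<lbrakk>g \<in> carrier G; x \<in> carrier G\<rbrakk> \<Longrightarrow> inv g \<otimes> (g \<otimes> x) = x"
  by (simp flip: m_assoc)

lemma conjugate_eq_image: "conjugate G g H = (\<lambda>h. g \<otimes> h \<otimes> inv g) ` H"
  by (auto simp: l_coset_def r_coset_def)

lemma mem_conjugate_iff:
  assumes "g \<in> carrier G" "H \<subseteq> carrier G"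
  shows "x \<in> conjugate G g H \<longleftrightarrow> x \<in> carrier G \<and> inv g \<otimes> x \<otimes> g \<in> H"
proof
  assume "x \<in> conjugate G g H"
  then obtain h where h: "h \<in> H" "x = g \<otimes> h \<otimes> inv g"
    by (auto simp: conjugate_eq_image)
  with assms have "h \<in> carrier G" by blast
  with h assms show "x \<in> carrier G \<and> inv g \<otimes> x \<otimes> g \<in> H"
    by (simp add: m_assoc mult_inv_mult inv_mult_mult)
next
  assume *: "x \<in> carrier G \<and> inv g \<otimes> x \<otimes> g \<in> H"
  then have "x = g \<otimes> (inv g \<otimes> x \<otimes> g) \<otimes> inv g"
    using assms by (simp add: m_assoc mult_inv_mult inv_mult_mult)
  with * show "x \<in> conjugate G g H" unfolding conjugate_eq_image by blast
qed

lemma conjugate_subset_carrier: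
  "\<lbrakk>g \<in> carrier G; H \<subseteq> carrier G\<rbrakk> \<Longrightarrow> conjugate G g H \<subseteq> carrier G"
  by (auto simp: mem_conjugate_iff)

lemma conjugate_conjugate:
  assumes "g \<in> carrier G" "g' \<in> carrier G" "H \<subseteq> carrier G"
  shows "conjugate G g (conjugate G g' H) = conjugate G (g \<otimes> g') H"
proof (rule Set.set_eqI)
  fix x
  note iff = mem_conjugate_iff[OF assms(2,3)]
    mem_conjugate_iff[OF assms(1) conjugate_subset_carrier[OF assms(2,3)], of x]
    mem_conjugate_iff[OF m_closed[OF assms(1,2)] assms(3), of x]
  show "x \<in> conjugate G g (conjugate G g' H) \<longleftrightarrow> x \<in> conjugate G (g \<otimes> g') H"
    unfolding iff using assms by (auto simp: inv_mult_group m_assoc)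
qed

lemma conjugate_one:
  assumes "H \<subseteq> carrier G"
  shows "conjugate G \<one> H = H"
proof -
  have "\<one> \<otimes> h \<otimes> inv \<one> = h" if "h \<in> H" for h
    using that assms by (simp add: subsetD)
  then show ?thesis by (simp only: conjugate_eq_image image_cong[OF refl] image_ident)
qed

lemma conjugate_inv_conjugate:
  assumes "g \<in> carrier G" "H \<subseteq> carrier G"
  shows "conjugate G (inv g) (conjugate G g H) = H" "conjugate G g (conjugate G (inv g) H) = H"
  using conjugate_conjugate[of "inv g" g H] conjugate_conjugate[of g "inv g" H] conjugate_one[of H] assms
  by (simp_all only: l_inv r_inv inv_closed)

lemma conjugate_mono_iff:
  assumes "g \<in> carrier G" "H \<subseteq> carrier G" "K \<subseteq> carrier G"
  shows "conjugate G g H \<subseteq> conjugate G g K \<longleftrightarrow> H \<subseteq> K"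
proof
  assume "conjugate G g H \<subseteq> conjugate G g K"
  then have "conjugate G (inv g) (conjugate G g H) \<subseteq> conjugate G (inv g) (conjugate G g K)"
    unfolding conjugate_eq_image[of "inv g"] by (rule image_mono)
  with assms show "H \<subseteq> K" by (simp only: conjugate_inv_conjugate)
qed (auto simp: conjugate_eq_image)

lemma bij_betw_conjugate:
  assumes "g \<in> carrier G" "\<And>H. H \<in> \<C> \<Longrightarrow> H \<subseteq> carrier G"
    and "\<And>H g. \<lbrakk>H \<in> \<C>; g \<in> carrier G\<rbrakk> \<Longrightarrow> conjugate G g H \<in> \<C>"
  shows "bij_betw (conjugate G g) \<C> \<C>"
proof (rule bij_betwI[where g = "conjugate G (inv g)"])
  show "conjugate G g \<in> \<C> \<rightarrow> \<C>" "conjugate G (inv g) \<in> \<C> \<rightarrow> \<C>"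
    using assms(1) by (auto simp only: inv_closed intro!: assms(3))
qed (simp_all only: conjugate_inv_conjugate assms(1,2))

text \<open>Conjugation by \<open>g\<close> is an automorphism of the poset \<open>\<C>\<close>, so
  it maps the part below \<open>H\<close> isomorphically onto the part below the conjugate of
  \<open>H\<close>.\<close>

lemma reduced_euler_characteristic_conjugate:
  assumes "g \<in> carrier G" "\<And>H. H \<in> \<C> \<Longrightarrow> H \<subseteq> carrier G" "H \<in> \<C>"
    and "\<And>H g. \<lbrakk>H \<in> \<C>; g \<in> carrier G\<rbrakk> \<Longrightarrow> conjugate G g H \<in> \<C>"
  shows "reduced_euler_characteristic {K \<in> \<C>. K \<subset> conjugate G g H}
    = reduced_euler_characteristic {K \<in> \<C>. K \<subset> H}"
proof -
  have strict: "conjugate G g K \<subset> conjugate G g H \<longleftrightarrow> K \<subset> H" if "K \<in> \<C>" for K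
    using that assms(1-3) by (simp add: psubset_eq[of _ H] less_le_not_le conjugate_mono_iff)
  have "bij_betw (conjugate G g) {K \<in> \<C>. K \<subset> H} {K \<in> \<C>. K \<subset> conjugate G g H}"
  proof (rule bij_betw_subset[OF bij_betw_conjugate[OF assms(1,2,4)]])
    have image: "f ` {K \<in> \<C>. P (f K)} = {L \<in> f ` \<C>. P L}" for f :: "'a set \<Rightarrow> 'a set" and P
      by auto
    have "{K \<in> \<C>. K \<subset> H} = {K \<in> \<C>. conjugate G g K \<subset> conjugate G g H}"
      by (simp only: strict cong: conj_cong)
    then show "conjugate G g ` {K \<in> \<C>. K \<subset> H} = {K \<in> \<C>. K \<subset> conjugate G g H}"
      by (simp only: image[of _ "\<lambda>L. L \<subset> conjugate G g H"]
          bij_betw_imp_surj_on[OF bij_betw_conjugate[OF assms(1,2,4)]])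
  qed auto
  then have "euler_characteristic {K \<in> \<C>. K \<subset> H} = euler_characteristic {K \<in> \<C>. K \<subset> conjugate G g H}"
    by (rule euler_characteristic_iso) (use assms(1,2) in \<open>simp add: conjugate_mono_iff\<close>)
  then show ?thesis by (simp add: reduced_euler_characteristic_def)
qed

text \<open>Double counting of pairs of \<open>H\<close> and \<open>g\<close>: after exchanging the
  sums, conjugation by a fixed \<open>g\<close> permutes \<open>\<C>\<close> and preserves
  \<open>f\<close>, so each \<open>g\<close> contributes the same sum.\<close>

lemma sum_card_conjugate:
  fixes f :: "'a set \<Rightarrow> 'c::comm_semiring_1"
  assumes "finite (carrier G)" "finite \<C>" "\<And>H. H \<in> \<C> \<Longrightarrow> H \<subseteq> carrier G"
    and closed: "\<And>H g. \<lbrakk>H \<in> \<C>; g \<in> carrier G\<rbrakk> \<Longrightarrow> conjugate G g H \<in> \<C>"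
    and f: "\<And>H g. \<lbrakk>H \<in> \<C>; g \<in> carrier G\<rbrakk> \<Longrightarrow> f (conjugate G g H) = f H"
  shows "(\<Sum>H\<in>\<C>. f H * of_nat (card {g \<in> carrier G. P (conjugate G g H)}))
    = of_nat (card (carrier G)) * (\<Sum>H | H \<in> \<C> \<and> P H. f H)"
proof -
  have "(\<Sum>H\<in>\<C>. f H * of_nat (card {g \<in> carrier G. P (conjugate G g H)}))
      = (\<Sum>H\<in>\<C>. \<Sum>g\<in>carrier G. f H * of_bool (P (conjugate G g H)))"
    using assms(1) by (simp add: sum_distrib_left[symmetric] Int_def)
  also have "\<dots> = (\<Sum>g\<in>carrier G. \<Sum>H\<in>\<C>. f H * of_bool (P (conjugate G g H)))"
    by (rule sum.swap)
  also have "\<dots> = (\<Sum>g\<in>carrier G. \<Sum>H | H \<in> \<C> \<and> P H. f H)"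
  proof (rule sum.cong)
    fix g assume g: "g \<in> carrier G"
    have "(\<Sum>H\<in>\<C>. f H * of_bool (P (conjugate G g H)))
        = (\<Sum>H\<in>\<C>. f (conjugate G g H) * of_bool (P (conjugate G g H)))"
      using f[OF _ g] by simp
    also have "\<dots> = (\<Sum>H\<in>\<C>. f H * of_bool (P H))"
      using bij_betw_conjugate[OF g assms(3) closed]
      by (rule sum.reindex_bij_betw)
    also have "\<dots> = (\<Sum>H | H \<in> \<C> \<and> P H. f H)"
      using assms(2) by (intro sum.mono_neutral_cong_right) auto
    finally show "(\<Sum>H\<in>\<C>. f H * of_bool (P (conjugate G g H))) = (\<Sum>H | H \<in> \<C> \<and> P H. f H)" .
  qed simp
  finally show ?thesis by simp
qed

lemma conjugate_self:
  assumes "subgroup H G" "h \<in> H"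
  shows "conjugate G h H = H"
proof -
  have sub: "H \<subseteq> carrier G" using assms(1) by (rule subgroup.subset)
  have le: "conjugate G k H \<subseteq> H" if "k \<in> H" for k
    using that assms(1) by (auto simp: conjugate_eq_image subgroup.m_closed subgroup.m_inv_closed)
  have h: "h \<in> carrier G" "inv h \<in> H"
    using assms sub by (auto simp: subgroup.m_inv_closed)
  have "conjugate G h (conjugate G (inv h) H) \<subseteq> conjugate G h H"
    using le[OF h(2)] unfolding conjugate_eq_image[of h] by (rule image_mono)
  with le[OF assms(2)] show ?thesis
    by (simp only: conjugate_inv_conjugate[OF h(1) sub] subset_antisym)
qed

section \<open>Centralizers and their conjugates\<close>

lemma centralizer_subset: "centralizer G H \<subseteq> carrier G"
  by (auto simp: centralizer_def)

lemma subgroup_centralizer: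
  assumes "H \<subseteq> carrier G"
  shows "subgroup (centralizer G H) G"
proof
  fix x y assume "x \<in> centralizer G H" "y \<in> centralizer G H"
  then show "x \<otimes> y \<in> centralizer G H"
    using assms unfolding centralizer_def by (simp add: subset_eq) (metis m_assoc)
next
  fix x assume x: "x \<in> centralizer G H"
  have "inv x \<otimes> h = h \<otimes> inv x" if "h \<in> H" for h
  proof -
    have "h \<in> carrier G" "x \<in> carrier G" "x \<otimes> h = h \<otimes> x"
      using x that assms by (auto simp: centralizer_def)
    then show ?thesis by (metis inv_closed inv_solve_left inv_solve_right m_assoc m_closed)
  qed
  with x show "inv x \<in> centralizer G H" by (simp add: centralizer_def)
qed (use assms in \<open>auto simp: centralizer_def\<close>)

text \<open>Both inclusions say that \<open>H\<close> and \<open>K\<close> commute elementwise. This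
  turns the fixed-point condition on cosets of a centralizer into containment in the centralizer of
  \<open>K\<close>.\<close>

lemma subset_centralizer_iff:
  "\<lbrakk>H \<subseteq> carrier G; K \<subseteq> carrier G\<rbrakk> \<Longrightarrow> K \<subseteq> centralizer G H \<longleftrightarrow> H \<subseteq> centralizer G K"
  by (auto simp: centralizer_def)

lemma conjugate_centralizer:
  assumes "g \<in> carrier G" "H \<subseteq> carrier G"
  shows "conjugate G g (centralizer G H) = centralizer G (conjugate G g H)"
proof -
  \<comment> \<open>Stated for arbitrary \<open>k\<close> and \<open>K\<close>, because the reverse
    inclusion comes from applying it to \<open>inv g\<close> and the conjugate of
    \<open>H\<close>.\<close>
  have le: "conjugate G k (centralizer G K) \<subseteq> centralizer G (conjugate G k K)"
    if "k \<in> carrier G" "K \<subseteq> carrier G" for k K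
  proof
    fix x assume "x \<in> conjugate G k (centralizer G K)"
    then obtain c where c: "c \<in> centralizer G K" "x = k \<otimes> c \<otimes> inv k"
      by (auto simp: conjugate_eq_image)
    have "k \<otimes> c \<otimes> inv k \<otimes> (k \<otimes> h \<otimes> inv k) = k \<otimes> h \<otimes> inv k \<otimes> (k \<otimes> c \<otimes> inv k)"
      if "h \<in> K" for h
    proof -
      have carr: "h \<in> carrier G" "c \<in> carrier G" and comm: "c \<otimes> h = h \<otimes> c"
        using c(1) that \<open>K \<subseteq> carrier G\<close> by (auto simp: centralizer_def)
      have "k \<otimes> a \<otimes> inv k \<otimes> (k \<otimes> b \<otimes> inv k) = k \<otimes> (a \<otimes> b) \<otimes> inv k"
        if "a \<in> carrier G" "b \<in> carrier G" for a b
        using that \<open>k \<in> carrier G\<close> by (simp add: m_assoc mult_inv_mult inv_mult_mult)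
      with carr comm show ?thesis by simp
    qed
    with c that show "x \<in> centralizer G (conjugate G k K)"
      by (auto simp: conjugate_eq_image centralizer_def)
  qed
  have "conjugate G (inv g) (centralizer G (conjugate G g H)) \<subseteq> centralizer G H"
    using le[OF inv_closed conjugate_subset_carrier, OF assms(1) assms]
    by (simp only: conjugate_inv_conjugate[OF assms])
  then have "conjugate G g (conjugate G (inv g) (centralizer G (conjugate G g H)))
      \<subseteq> conjugate G g (centralizer G H)"
    unfolding conjugate_eq_image[of g] by (rule image_mono)
  then show ?thesis
    using le[OF assms]
    by (simp only: conjugate_inv_conjugate[OF assms(1) centralizer_subset] subset_antisym)
qed

section \<open>Double cosets and fixed points on coset spaces\<close>

lemma mem_double_coset_iff:
  "x \<in> (L #> g) <#> H \<longleftrightarrow> (\<exists>l\<in>L. \<exists>h\<in>H. x = l \<otimes> g \<otimes> h)"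
  by (auto simp: r_coset_def set_mult_def)

lemma double_coset_repsE:
  assumes "double_coset_reps G L K H R" "x \<in> K"
  obtains g l h where "g \<in> R" "l \<in> L" "h \<in> H" "x = l \<otimes> g \<otimes> h"
proof -
  have "\<exists>g. g \<in> R \<and> x \<in> (L #> g) <#> H"
    using assms by (intro ex1_implies_ex) (simp add: double_coset_reps_def)
  then show thesis using that by (auto simp: mem_double_coset_iff)
qed

lemma double_coset_eq:
  assumes "subgroup L G" "subgroup H G" "g \<in> carrier G" "x \<in> (L #> g) <#> H"
  shows "(L #> x) <#> H = (L #> g) <#> H"
proof -
  interpret L: subgroup L G by fact
  interpret H: subgroup H G by fact
  obtain l h where lh: "l \<in> L" "h \<in> H" "x = l \<otimes> g \<otimes> h"
    using assms(4) by (auto simp: mem_double_coset_iff)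
  have "a \<otimes> x \<otimes> b = (a \<otimes> l) \<otimes> g \<otimes> (h \<otimes> b)" if "a \<in> L" "b \<in> H" for a b
    using that lh assms(3) by (simp add: m_assoc)
  moreover have "a \<otimes> g \<otimes> b = (a \<otimes> inv l) \<otimes> x \<otimes> (inv h \<otimes> b)" if "a \<in> L" "b \<in> H" for a b
    using that lh assms(3) by (simp add: m_assoc mult_inv_mult inv_mult_mult)
  ultimately show ?thesis
    using lh(1,2) by (auto simp: mem_double_coset_iff) (metis L.m_closed H.m_closed L.m_inv_closed H.m_inv_closed)+
qed

lemma double_coset_reps_exist:
  assumes "subgroup L G" "subgroup H G" "subgroup K G" "L \<subseteq> K" "H \<subseteq> K"
  obtains R where "double_coset_reps G L K H R"
proof -
  define D where "D x = (L #> x) <#> H" for x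
  \<comment> \<open>The choice depends only on the set \<open>D x\<close>, so all elements of one
    double coset get the same representative.\<close>
  define r where "r x = (SOME y. y \<in> D x)" for x
  have K: "K \<subseteq> carrier G" using assms(3) by (rule subgroup.subset)
  have self: "x \<in> D x" if "x \<in> carrier G" for x
    unfolding D_def mem_double_coset_iff
    using that assms(1,2) by (intro bexI[of _ \<one>]) (auto simp: subgroup.one_closed)
  have r: "r x \<in> D x" if "x \<in> carrier G" for x
    unfolding r_def using self[OF that] by (rule someI)
  have D_le: "D x \<subseteq> K" if "x \<in> K" for x
    using that assms(3-5) by (auto simp: D_def mem_double_coset_iff subset_eq subgroup.m_closed)
  have eq: "D y = D x" if "y \<in> D x" "x \<in> carrier G" for x y
    using that double_coset_eq[OF assms(1,2)] by (simp add: D_def)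
  have "double_coset_reps G L K H (r ` K)"
    unfolding double_coset_reps_def D_def[symmetric]
  proof (intro conjI ballI)
    show "r ` K \<subseteq> K" using r D_le K by blast
    fix x assume x: "x \<in> K"
    show "\<exists>!g. g \<in> r ` K \<and> x \<in> D g"
    proof (rule ex1I[of _ "r x"])
      show "r x \<in> r ` K \<and> x \<in> D (r x)"
        using x K eq[OF r] self by blast
      fix g assume g: "g \<in> r ` K \<and> x \<in> D g"
      then obtain y where y: "y \<in> K" "g = r y" by blast
      then have "D g = D y" using eq r K by blast
      with g y K eq have "D x = D y" by blast
      then have "r x = r y" by (simp add: r_def)
      with y show "g = r x" by simp
    qed
  qed
  then show thesis by (rule that)
qed

text \<open>\<open>M\<close> lies in \<open>conjugate G g H\<close> exactly when \<open>M\<close>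
  fixes the coset \<open>gH\<close>. The double coset of \<open>g\<close> is then \<open>gH\<close>
  itself, so each counted representative accounts for \<open>card H\<close> elements.\<close>

lemma card_fixed_points:
  assumes "subgroup H G" "subgroup M G" and R: "double_coset_reps G M (carrier G) H R"
  shows "card {g \<in> carrier G. M \<subseteq> conjugate G g H}
    = card {g \<in> R. M \<subseteq> conjugate G g H} * card H"
proof -
  interpret H: subgroup H G by fact
  interpret M: subgroup M G by fact
  let ?R = "{g \<in> R. M \<subseteq> conjugate G g H}"
  let ?S = "{g \<in> carrier G. M \<subseteq> conjugate G g H}"
  have R_carrier: "g \<in> carrier G" if "g \<in> R" for g
    using that R by (auto simp: double_coset_reps_def)
  have R_unique: "g = g'" if "x \<in> carrier G" "g \<in> R" "x \<in> (M #> g) <#> H" "g' \<in> R" "x \<in> (M #> g') <#> H" for x g g'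
    using that R unfolding double_coset_reps_def by metis
  have "bij_betw (\<lambda>(g, h). g \<otimes> h) (?R \<times> H) ?S"
    unfolding bij_betw_def
  proof
    have mem: "g \<otimes> h \<in> (M #> g) <#> H" if "g \<in> R" "h \<in> H" for g h
      unfolding mem_double_coset_iff
      using that R_carrier by (intro bexI[of _ \<one>] bexI[of _ h]) auto
    show "inj_on (\<lambda>(g, h). g \<otimes> h) (?R \<times> H)"
    proof (clarsimp simp: inj_on_def)
      fix g h g' h' assume *: "g \<in> R" "h \<in> H" "g' \<in> R" "h' \<in> H" "g \<otimes> h = g' \<otimes> h'"
      then have "g = g'" using R_unique[of "g \<otimes> h" g g'] mem R_carrier by (metis H.mem_carrier m_closed)
      with * R_carrier show "g = g' \<and> h = h'" by simp
    qed
    show "(\<lambda>(g, h). g \<otimes> h) ` (?R \<times> H) = ?S"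
    proof (intro equalityI subsetI)
      fix x assume "x \<in> (\<lambda>(g, h). g \<otimes> h) ` (?R \<times> H)"
      then obtain g h where gh: "g \<in> R" "M \<subseteq> conjugate G g H" "h \<in> H" "x = g \<otimes> h" by auto
      have "conjugate G x H = conjugate G g (conjugate G h H)"
        unfolding gh(4) using gh R_carrier by (intro conjugate_conjugate[symmetric]) auto
      with gh assms(1) R_carrier show "x \<in> ?S" by (simp add: conjugate_self)
    next
      fix x assume x: "x \<in> ?S"
      then obtain g where g: "g \<in> R" "x \<in> (M #> g) <#> H"
        using R unfolding double_coset_reps_def by (metis (no_types, lifting) mem_Collect_eq)
      then obtain m h where mh: "m \<in> M" "h \<in> H" "x = m \<otimes> g \<otimes> h"
        by (auto simp: mem_double_coset_iff)
      have carr: "m \<in> carrier G" "h \<in> carrier G" "g \<in> carrier G"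
        using mh g R_carrier by auto
      \<comment> \<open>Conjugation by \<open>m\<close> preserves \<open>M\<close> and conjugation
        by \<open>h\<close> preserves \<open>H\<close>, so the containment passes from
        \<open>x\<close> to its representative \<open>g\<close>.\<close>
      have "conjugate G m M \<subseteq> conjugate G x H"
        using x conjugate_self[OF assms(2) mh(1)] by simp
      also have "conjugate G x H = conjugate G m (conjugate G g (conjugate G h H))"
        using carr unfolding mh(3)
        by (simp add: conjugate_conjugate conjugate_subset_carrier H.subset m_assoc)
      also have "\<dots> = conjugate G m (conjugate G g H)"
        using conjugate_self[OF assms(1) mh(2)] by simp
      finally have M: "M \<subseteq> conjugate G g H"
        using carr by (simp add: conjugate_mono_iff conjugate_subset_carrier H.subset M.subset)
      \<comment> \<open>Moving the factor \<open>m\<close> past \<open>g\<close> lands it in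
        \<open>H\<close>, which puts \<open>x\<close> into the single coset of
        \<open>g\<close>.\<close>
      then have "inv g \<otimes> m \<otimes> g \<in> H"
        using mh(1) carr H.subset by (auto simp: mem_conjugate_iff)
      then have "inv g \<otimes> m \<otimes> g \<otimes> h \<in> H" using mh(2) by blast
      moreover have "x = g \<otimes> (inv g \<otimes> m \<otimes> g \<otimes> h)"
        using mh carr by (simp add: m_assoc mult_inv_mult inv_mult_mult)
      ultimately show "x \<in> (\<lambda>(g, h). g \<otimes> h) ` (?R \<times> H)"
        using g(1) M by force
    qed
  qed
  then show ?thesis
    by (simp add: bij_betw_same_card[symmetric] card_cartesian_product)
qed

end

subsection \<open>Restriction modulo proper induction\<close>

lemma rat_field_simps [simp]:
  "carrier rat_field = UNIV" "a \<oplus>\<^bsub>rat_field\<^esub> b = a + b" "a \<otimes>\<^bsub>rat_field\<^esub> b = a * b"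
  "\<one>\<^bsub>rat_field\<^esub> = 1" "\<zero>\<^bsub>rat_field\<^esub> = 0"
  by (simp_all add: ring_of_type_algebra_def)

context rational_green_functor
begin

lemma A_ring: "subgroup H G \<Longrightarrow> ring (A H)"
  using algebra[of H] by (simp add: associative_algebra_def)

lemma finite_proper_subgroups: "finite {L. subgroup L G \<and> L \<subset> K}"
  using finite_carrier
  by (auto intro!: finite_subset[of _ "Pow (carrier G)"] dest: subgroup.subset)

lemma A_module: "subgroup H G \<Longrightarrow> module rat_field (A H)"
  using algebra[of H] by (simp add: associative_algebra_def)

lemma A_abelian_monoid: "subgroup H G \<Longrightarrow> abelian_monoid (A H)"
  using A_ring[of H] by (simp add: ring_def abelian_group_def)

lemma linear_map_zero:
  assumes "subgroup H G" "subgroup K G" "f \<in> linear_maps rat_field (A H) (A K)"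
  shows "f \<zero>\<^bsub>A H\<^esub> = \<zero>\<^bsub>A K\<^esub>"
proof -
  interpret H: module rat_field "A H" using assms(1) by (rule A_module)
  interpret K: module rat_field "A K" using assms(2) by (rule A_module)
  \<comment> \<open>With zero written as \<open>0\<close> times zero, homogeneity alone yields
    preservation of zero.\<close>
  have closed: "f \<zero>\<^bsub>A H\<^esub> \<in> carrier (A K)"
    and eq: "f (0 \<odot>\<^bsub>A H\<^esub> \<zero>\<^bsub>A H\<^esub>) = 0 \<odot>\<^bsub>A K\<^esub> f \<zero>\<^bsub>A H\<^esub>"
    using assms(3) H.M.zero_closed by (auto simp: linear_maps_def simp del: H.smult_l_null H.smult_r_null)
  show ?thesis
    using eq H.smult_l_null[OF H.M.zero_closed] K.smult_l_null[OF closed] by simp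
qed

section \<open>Elementary rules for restriction and induction\<close>

context
  fixes H K
  assumes HK: "subgroup H G" "subgroup K G" "H \<subseteq> K"
begin

lemma res_closed: "x \<in> carrier (A K) \<Longrightarrow> res K H x \<in> carrier (A H)"
  using res_linear[OF HK] by (auto simp: linear_maps_def)

lemma res_add: "\<lbrakk>x \<in> carrier (A K); y \<in> carrier (A K)\<rbrakk> \<Longrightarrow>
    res K H (x \<oplus>\<^bsub>A K\<^esub> y) = res K H x \<oplus>\<^bsub>A H\<^esub> res K H y"
  using res_linear[OF HK] by (auto simp: linear_maps_def)

lemma res_smult: "x \<in> carrier (A K) \<Longrightarrow> res K H (c \<odot>\<^bsub>A K\<^esub> x) = c \<odot>\<^bsub>A H\<^esub> res K H x"
  using res_linear[OF HK] by (auto simp: linear_maps_def)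

lemma res_mult: "\<lbrakk>x \<in> carrier (A K); y \<in> carrier (A K)\<rbrakk> \<Longrightarrow>
    res K H (x \<otimes>\<^bsub>A K\<^esub> y) = res K H x \<otimes>\<^bsub>A H\<^esub> res K H y"
  using res_ring_hom[OF HK] by (auto simp: ring_hom_def)

lemma res_one: "res K H \<one>\<^bsub>A K\<^esub> = \<one>\<^bsub>A H\<^esub>"
  using res_ring_hom[OF HK] by (auto simp: ring_hom_def)

lemma res_zero: "res K H \<zero>\<^bsub>A K\<^esub> = \<zero>\<^bsub>A H\<^esub>"
  using linear_map_zero[OF HK(2,1) res_linear[OF HK]] .

lemma res_finsum:
  assumes "finite S" "\<And>s. s \<in> S \<Longrightarrow> x s \<in> carrier (A K)"
  shows "res K H (\<Oplus>\<^bsub>A K\<^esub>s\<in>S. x s) = (\<Oplus>\<^bsub>A H\<^esub>s\<in>S. res K H (x s))"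
proof -
  interpret AH: abelian_monoid "A H" using HK(1) by (rule A_abelian_monoid)
  interpret AK: abelian_monoid "A K" using HK(2) by (rule A_abelian_monoid)
  show ?thesis
    using assms
  proof (induction S rule: finite_induct)
    case (insert s S)
    then have "(\<Oplus>\<^bsub>A K\<^esub>s\<in>insert s S. x s) = x s \<oplus>\<^bsub>A K\<^esub> (\<Oplus>\<^bsub>A K\<^esub>s\<in>S. x s)"
      "(\<Oplus>\<^bsub>A H\<^esub>s\<in>insert s S. res K H (x s)) = res K H (x s) \<oplus>\<^bsub>A H\<^esub> (\<Oplus>\<^bsub>A H\<^esub>s\<in>S. res K H (x s))"
      by (auto intro!: AK.finsum_insert AH.finsum_insert res_closed)
    with insert show ?case by (simp add: res_add AK.finsum_closed Pi_iff)
  qed (simp add: res_zero)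
qed

lemma ind_closed: "x \<in> carrier (A H) \<Longrightarrow> ind H K x \<in> carrier (A K)"
  using ind_linear[OF HK] by (auto simp: linear_maps_def)

lemma ind_smult: "x \<in> carrier (A H) \<Longrightarrow> ind H K (c \<odot>\<^bsub>A H\<^esub> x) = c \<odot>\<^bsub>A K\<^esub> ind H K x"
  using ind_linear[OF HK] by (auto simp: linear_maps_def)

lemma ind_zero: "ind H K \<zero>\<^bsub>A H\<^esub> = \<zero>\<^bsub>A K\<^esub>"
  using linear_map_zero[OF HK(1,2) ind_linear[OF HK]] .

end

text \<open>Finite sums of proper inductions, built one summand at a time: by rule induction a
  closure property reduces to a single induced element, without families indexed by
  subgroups.\<close>

inductive_set proper_ind :: "'g set \<Rightarrow> 'a set" for K where
  zero: "\<zero>\<^bsub>A K\<^esub> \<in> proper_ind K"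
| ind_add: "\<lbrakk>subgroup L G; L \<subset> K; a \<in> carrier (A L); y \<in> proper_ind K\<rbrakk> \<Longrightarrow>
    ind L K a \<oplus>\<^bsub>A K\<^esub> y \<in> proper_ind K"

text \<open>Congruence of \<open>x\<close> to a scalar modulo the ideal. It is a relation because an
  element need not be congruent to any scalar, and because the scalar is not unique when the ideal
  is all of \<open>A K\<close>.\<close>

definition scalar_mod_ind :: "'g set \<Rightarrow> 'a \<Rightarrow> rat \<Rightarrow> bool" where
  "scalar_mod_ind K x c \<longleftrightarrow> (\<exists>i\<in>proper_ind K. x = c \<odot>\<^bsub>A K\<^esub> \<one>\<^bsub>A K\<^esub> \<oplus>\<^bsub>A K\<^esub> i)"

section \<open>Closure properties of the ideal\<close>

context
  fixes K
  assumes K: "subgroup K G"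
begin

interpretation AK: associative_algebra rat_field "A K"
  by (rule algebra[OF K])

lemma ind_closed': "\<lbrakk>subgroup L G; L \<subset> K; a \<in> carrier (A L)\<rbrakk> \<Longrightarrow> ind L K a \<in> carrier (A K)"
  by (rule ind_closed[OF _ K]) auto

lemma proper_ind_carrier: "x \<in> proper_ind K \<Longrightarrow> x \<in> carrier (A K)"
  by (induction rule: proper_ind.induct) (auto intro: ind_closed')

lemma ind_proper_ind:
  assumes "subgroup L G" "L \<subset> K" "a \<in> carrier (A L)"
  shows "ind L K a \<in> proper_ind K"
  using proper_ind.ind_add[OF assms proper_ind.zero] ind_closed'[OF assms] by simp

lemma proper_ind_add:
  assumes "x \<in> proper_ind K" "y \<in> proper_ind K"
  shows "x \<oplus>\<^bsub>A K\<^esub> y \<in> proper_ind K"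
  using assms(1)
proof (induction rule: proper_ind.induct)
  case zero
  then show ?case using assms(2) proper_ind_carrier by simp
next
  case (ind_add L a z)
  then have "ind L K a \<oplus>\<^bsub>A K\<^esub> (z \<oplus>\<^bsub>A K\<^esub> y) \<in> proper_ind K"
    by (intro proper_ind.ind_add)
  with ind_add assms(2) show ?case
    by (simp add: AK.M.a_assoc ind_closed' proper_ind_carrier)
qed

lemma proper_ind_smult: "x \<in> proper_ind K \<Longrightarrow> c \<odot>\<^bsub>A K\<^esub> x \<in> proper_ind K"
proof (induction rule: proper_ind.induct)
  case zero
  then show ?case using proper_ind.zero by simp
next
  case (ind_add L a z)
  interpret AL: associative_algebra rat_field "A L"
    by (rule algebra[OF ind_add(1)])
  have "ind L K (c \<odot>\<^bsub>A L\<^esub> a) \<oplus>\<^bsub>A K\<^esub> c \<odot>\<^bsub>A K\<^esub> z \<in> proper_ind K"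
    using ind_add by (intro proper_ind.ind_add) auto
  with ind_add show ?case
    by (simp add: AK.smult_r_distr ind_closed' proper_ind_carrier ind_smult[OF _ K] psubset_imp_subset)
qed

text \<open>Frobenius reciprocity absorbs \<open>b\<close> into each induced summand, where it
  becomes the factor \<open>res K L b\<close>.\<close>

lemma proper_ind_mult_right:
  assumes "x \<in> proper_ind K" "b \<in> carrier (A K)"
  shows "x \<otimes>\<^bsub>A K\<^esub> b \<in> proper_ind K"
  using assms(1)
proof (induction rule: proper_ind.induct)
  case zero
  then show ?case using assms(2) proper_ind.zero by simp
next
  case (ind_add L a z)
  interpret AL: associative_algebra rat_field "A L"
    by (rule algebra[OF ind_add(1)])
  have "ind L K (a \<otimes>\<^bsub>A L\<^esub> res K L b) \<oplus>\<^bsub>A K\<^esub> z \<otimes>\<^bsub>A K\<^esub> b \<in> proper_ind K"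
    using ind_add assms(2) res_closed[OF ind_add(1) K] by (intro proper_ind.ind_add) auto
  with ind_add assms(2) show ?case
    by (simp add: AK.M.l_distr ind_closed' proper_ind_carrier frobenius_left K psubset_imp_subset)
qed

text \<open>By Frobenius reciprocity each product is a sum of inductions of elements with a factor
  \<open>res K L b\<close>, and these factors vanish.\<close>

lemma mult_proper_ind_eq_zero:
  assumes "x \<in> proper_ind K" "b \<in> carrier (A K)"
    and "\<And>L. \<lbrakk>subgroup L G; L \<subset> K\<rbrakk> \<Longrightarrow> res K L b = \<zero>\<^bsub>A L\<^esub>"
  shows "x \<otimes>\<^bsub>A K\<^esub> b = \<zero>\<^bsub>A K\<^esub>" "b \<otimes>\<^bsub>A K\<^esub> x = \<zero>\<^bsub>A K\<^esub>"
proof -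
  have "x \<otimes>\<^bsub>A K\<^esub> b = \<zero>\<^bsub>A K\<^esub> \<and> b \<otimes>\<^bsub>A K\<^esub> x = \<zero>\<^bsub>A K\<^esub>"
    using assms(1)
  proof (induction rule: proper_ind.induct)
    case zero
    then show ?case using assms(2) by simp
  next
    case (ind_add L a z)
    interpret AL: associative_algebra rat_field "A L"
      by (rule algebra[OF ind_add(1)])
    have "ind L K a \<otimes>\<^bsub>A K\<^esub> b = \<zero>\<^bsub>A K\<^esub>" "b \<otimes>\<^bsub>A K\<^esub> ind L K a = \<zero>\<^bsub>A K\<^esub>"
      using ind_add assms(2,3)
      by (simp_all add: frobenius_left frobenius_right ind_zero K psubset_imp_subset)
    with ind_add assms(2) show ?case
      by (simp add: AK.M.l_distr AK.M.r_distr ind_closed' proper_ind_carrier)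
  qed
  then show "x \<otimes>\<^bsub>A K\<^esub> b = \<zero>\<^bsub>A K\<^esub>" "b \<otimes>\<^bsub>A K\<^esub> x = \<zero>\<^bsub>A K\<^esub>" by auto
qed

text \<open>If \<open>K\<close> is not primordial, every element is a sum of inductions over a
  family indexed by all proper subgroups, and such sums lie in the ideal.\<close>

lemma carrier_eq_proper_ind_if_not_primordial:
  assumes "\<not> primordial G A ind K"
  shows "carrier (A K) = proper_ind K"
proof -
  define \<P> where "\<P> = {L. subgroup L G \<and> L \<subset> K}"
  have fin: "finite \<P>"
    unfolding \<P>_def by (rule finite_proper_subgroups)
  \<comment> \<open>Partial sums of one fixed family \<open>a\<close>, so that finite induction on
    \<open>S\<close> reaches the sum over all of \<open>\<P>\<close>.\<close>
  have "(\<Oplus>\<^bsub>A K\<^esub>L\<in>S. ind L K (a L)) \<in> proper_ind K"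
    if "a \<in> (\<Pi>\<^sub>E L\<in>\<P>. carrier (A L))" "S \<subseteq> \<P>" for a S
  proof -
    have "finite S" using that(2) fin by (rule finite_subset)
    then show ?thesis using that(2)
    proof (induction S rule: finite_induct)
      case empty
      then show ?case by (simp add: proper_ind.zero)
    next
      case (insert L S)
      have "ind J K (a J) \<in> carrier (A K)" if "J \<in> \<P>" for J
        using that \<open>a \<in> _\<close> by (intro ind_closed') (auto simp: \<P>_def)
      moreover have "ind L K (a L) \<oplus>\<^bsub>A K\<^esub> (\<Oplus>\<^bsub>A K\<^esub>L\<in>S. ind L K (a L)) \<in> proper_ind K"
        using insert that(1) by (intro proper_ind.ind_add) (auto simp: \<P>_def)
      ultimately show ?case
        using insert by (subst AK.M.finsum_insert) auto
    qed
  qed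
  then have "(\<lambda>a. \<Oplus>\<^bsub>A K\<^esub>L\<in>\<P>. ind L K (a L)) ` (\<Pi>\<^sub>E L\<in>\<P>. carrier (A L)) \<subseteq> proper_ind K"
    by blast
  moreover have "(\<lambda>a. \<Oplus>\<^bsub>A K\<^esub>L\<in>\<P>. ind L K (a L)) ` (\<Pi>\<^sub>E L\<in>\<P>. carrier (A L)) = carrier (A K)"
    using assms K by (simp add: primordial_def \<P>_def Let_def)
  ultimately show ?thesis using proper_ind_carrier by blast
qed

section \<open>Arithmetic of scalars modulo the ideal\<close>

lemma scalar_mod_ind_carrier: "scalar_mod_ind K x c \<Longrightarrow> x \<in> carrier (A K)"
  by (auto simp: scalar_mod_ind_def proper_ind_carrier)

lemma scalar_mod_ind_zero_iff: "scalar_mod_ind K x 0 \<longleftrightarrow> x \<in> proper_ind K"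
  using AK.smult_l_null[of "\<one>\<^bsub>A K\<^esub>"] by (auto simp: scalar_mod_ind_def proper_ind_carrier)

lemma scalar_mod_ind_one: "scalar_mod_ind K \<one>\<^bsub>A K\<^esub> 1"
  using AK.smult_one[of "\<one>\<^bsub>A K\<^esub>"] by (auto simp: scalar_mod_ind_def intro!: bexI[OF _ proper_ind.zero])

lemma scalar_mod_ind_add:
  assumes "scalar_mod_ind K x c" "scalar_mod_ind K y d"
  shows "scalar_mod_ind K (x \<oplus>\<^bsub>A K\<^esub> y) (c + d)"
proof -
  obtain i j where ij: "i \<in> proper_ind K" "x = c \<odot>\<^bsub>A K\<^esub> \<one>\<^bsub>A K\<^esub> \<oplus>\<^bsub>A K\<^esub> i"
    "j \<in> proper_ind K" "y = d \<odot>\<^bsub>A K\<^esub> \<one>\<^bsub>A K\<^esub> \<oplus>\<^bsub>A K\<^esub> j"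
    using assms by (auto simp: scalar_mod_ind_def)
  have "(c + d) \<odot>\<^bsub>A K\<^esub> \<one>\<^bsub>A K\<^esub> = c \<odot>\<^bsub>A K\<^esub> \<one>\<^bsub>A K\<^esub> \<oplus>\<^bsub>A K\<^esub> d \<odot>\<^bsub>A K\<^esub> \<one>\<^bsub>A K\<^esub>"
    using AK.smult_l_distr[of c d "\<one>\<^bsub>A K\<^esub>"] by simp
  then have "x \<oplus>\<^bsub>A K\<^esub> y = (c + d) \<odot>\<^bsub>A K\<^esub> \<one>\<^bsub>A K\<^esub> \<oplus>\<^bsub>A K\<^esub> (i \<oplus>\<^bsub>A K\<^esub> j)"
    using ij by (simp add: proper_ind_carrier AK.M.a_ac)
  then show ?thesis
    using proper_ind_add[OF ij(1,3)] by (auto simp: scalar_mod_ind_def)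
qed

lemma scalar_mod_ind_smult:
  assumes "scalar_mod_ind K x c"
  shows "scalar_mod_ind K (q \<odot>\<^bsub>A K\<^esub> x) (q * c)"
proof -
  obtain i where i: "i \<in> proper_ind K" "x = c \<odot>\<^bsub>A K\<^esub> \<one>\<^bsub>A K\<^esub> \<oplus>\<^bsub>A K\<^esub> i"
    using assms by (auto simp: scalar_mod_ind_def)
  have "(q * c) \<odot>\<^bsub>A K\<^esub> \<one>\<^bsub>A K\<^esub> = q \<odot>\<^bsub>A K\<^esub> (c \<odot>\<^bsub>A K\<^esub> \<one>\<^bsub>A K\<^esub>)"
    using AK.smult_assoc1[of q c "\<one>\<^bsub>A K\<^esub>"] by simp
  then have "q \<odot>\<^bsub>A K\<^esub> x = (q * c) \<odot>\<^bsub>A K\<^esub> \<one>\<^bsub>A K\<^esub> \<oplus>\<^bsub>A K\<^esub> q \<odot>\<^bsub>A K\<^esub> i"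
    using i by (simp add: proper_ind_carrier AK.smult_r_distr)
  then show ?thesis
    using proper_ind_smult[OF i(1)] by (auto simp: scalar_mod_ind_def)
qed

text \<open>Writing \<open>x\<close> as the identity plus \<open>i\<close> turns the product into
  \<open>y\<close> plus \<open>i\<close> times \<open>y\<close>, and the second summand stays in the
  ideal.\<close>

lemma scalar_mod_ind_mult_one:
  assumes "scalar_mod_ind K x 1" "scalar_mod_ind K y 1"
  shows "scalar_mod_ind K (x \<otimes>\<^bsub>A K\<^esub> y) 1"
proof -
  obtain i where i: "i \<in> proper_ind K" "x = \<one>\<^bsub>A K\<^esub> \<oplus>\<^bsub>A K\<^esub> i"
    using assms(1) AK.smult_one[of "\<one>\<^bsub>A K\<^esub>"] by (auto simp: scalar_mod_ind_def)
  have "x \<otimes>\<^bsub>A K\<^esub> y = y \<oplus>\<^bsub>A K\<^esub> i \<otimes>\<^bsub>A K\<^esub> y"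
    using i scalar_mod_ind_carrier[OF assms(2)] by (simp add: AK.M.l_distr proper_ind_carrier)
  moreover have "scalar_mod_ind K (i \<otimes>\<^bsub>A K\<^esub> y) 0"
    using i(1) scalar_mod_ind_carrier[OF assms(2)] by (simp add: scalar_mod_ind_zero_iff proper_ind_mult_right)
  ultimately show ?thesis using scalar_mod_ind_add[OF assms(2)] by fastforce
qed

lemma scalar_mod_ind_finsum:
  assumes "finite S" "\<And>s. s \<in> S \<Longrightarrow> scalar_mod_ind K (x s) (c s)"
  shows "scalar_mod_ind K (\<Oplus>\<^bsub>A K\<^esub>s\<in>S. x s) (\<Sum>s\<in>S. c s)"
  using assms
proof (induction S rule: finite_induct)
  case empty
  then show ?case by (simp add: scalar_mod_ind_zero_iff proper_ind.zero)
next
  case (insert s S)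
  then show ?case
    using scalar_mod_ind_carrier scalar_mod_ind_add[of "x s" "c s"]
    by (subst AK.M.finsum_insert) auto
qed

text \<open>
  The rational number is the number of fixed points of \<open>K\<close> on the cosets of \<open>H\<close> in \<open>J\<close>.
\<close>

lemma res_ind_one_mod_ind:
  assumes "subgroup H G" "subgroup J G" "H \<subseteq> J" "K \<subseteq> J" and R: "double_coset_reps G K J H R"
  shows "scalar_mod_ind K (res J K (ind H J \<one>\<^bsub>A H\<^esub>)) (of_nat (card {g \<in> R. K \<subseteq> conjugate G g H}))"
proof -
  interpret AH: associative_algebra rat_field "A H" by (rule algebra[OF assms(1)])
  have R_carrier: "R \<subseteq> carrier G"
    using R subgroup.subset[OF assms(2)] by (auto simp: double_coset_reps_def)
  then have "finite R" using finite_carrier finite_subset by blast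
  \<comment> \<open>In a Mackey summand the identity is induced from
    \<open>K \<inter> conjugate G g H\<close>. This is either all of \<open>K\<close> or a proper
    subgroup, so the summand is the identity or lies in the ideal.\<close>
  have summand: "scalar_mod_ind K (ind (K \<inter> conjugate G g H) K
      (res (conjugate G g H) (K \<inter> conjugate G g H) (cj g H \<one>\<^bsub>A H\<^esub>))) (of_bool (K \<subseteq> conjugate G g H))"
    if "g \<in> R" for g
  proof -
    have g: "g \<in> carrier G" using that R_carrier by blast
    have conj: "subgroup (conjugate G g H) G"
      using g assms(1) by (rule subgroup_conjugation_is_surj2)
    have int: "subgroup (K \<inter> conjugate G g H) G"
      using subgroups_Inter_pair[OF K conj] .
    have "cj g H \<one>\<^bsub>A H\<^esub> = \<one>\<^bsub>A (conjugate G g H)\<^esub>"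
      using cj_ring_hom[OF assms(1) g] by (simp add: ring_hom_def)
    then have one: "res (conjugate G g H) (K \<inter> conjugate G g H) (cj g H \<one>\<^bsub>A H\<^esub>)
        = \<one>\<^bsub>A (K \<inter> conjugate G g H)\<^esub>"
      using res_one[OF int conj] by simp
    interpret I: associative_algebra rat_field "A (K \<inter> conjugate G g H)" by (rule algebra[OF int])
    show ?thesis
    proof (cases "K \<subseteq> conjugate G g H")
      case True
      then have "K \<inter> conjugate G g H = K" by blast
      then show ?thesis
        unfolding one using True scalar_mod_ind_one K by (simp add: ind_id)
    next
      case False
      then have "K \<inter> conjugate G g H \<subset> K" by blast
      then show ?thesis
        unfolding one using False int
        by (simp add: scalar_mod_ind_zero_iff ind_proper_ind)
    qed
  qed
  have "(\<Sum>g\<in>R. of_bool (K \<subseteq> conjugate G g H) :: rat) = of_nat (card {g \<in> R. K \<subseteq> conjugate G g H})"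
    using \<open>finite R\<close> by (simp add: Int_def)
  with scalar_mod_ind_finsum[OF \<open>finite R\<close> summand, of "\<lambda>g. g"] show ?thesis
    by (simp add: mackey[OF assms(1) K assms(2,3,4) R])
qed

end

section \<open>Separating elements by their restrictions\<close>

text \<open>
  With \<open>b = ind\<^bsub>M\<^esub>\<^bsup>K\<^esup> 1\<close>, a suitable \<open>1 - b/n\<close> restricts into \<open>proper_ind M\<close>; the
  witness is the product of these elements over all \<open>M\<close>, taken in increasing order.
\<close>

lemma exists_one_mod_ind_res_eq_zero:
  assumes K: "subgroup K G"
  obtains e where "scalar_mod_ind K e 1"
    and "\<And>L. \<lbrakk>subgroup L G; L \<subset> K\<rbrakk> \<Longrightarrow> res K L e = \<zero>\<^bsub>A L\<^esub>"
proof -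
  interpret AK: associative_algebra rat_field "A K" by (rule algebra[OF K])
  define \<P> where "\<P> = {L. subgroup L G \<and> L \<subset> K}"
  have "finite \<P>"
    unfolding \<P>_def by (rule finite_proper_subgroups)
  \<comment> \<open>Induction over sets \<open>S\<close> of proper subgroups that are closed under
    passing to smaller subgroups. Removing a maximal member \<open>M\<close> preserves this
    closure.\<close>
  have "\<exists>e. scalar_mod_ind K e 1 \<and> (\<forall>L\<in>S. res K L e = \<zero>\<^bsub>A L\<^esub>)"
    if "finite S" "S \<subseteq> \<P>" "\<And>L N. \<lbrakk>L \<in> S; subgroup N G; N \<subset> L\<rbrakk> \<Longrightarrow> N \<in> S" for S
    using that
  proof (induction S rule: finite_psubset_induct)
    case (psubset S)
    show ?case
    proof (cases "S = {}")
      case True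
      then show ?thesis using scalar_mod_ind_one[OF K] by blast
    next
      case False
      then obtain M where M: "M \<in> S" and max: "\<And>L. L \<in> S \<Longrightarrow> M \<subseteq> L \<Longrightarrow> M = L"
        using finite_has_maximal[OF psubset.hyps(1)] by metis
      then have MK: "subgroup M G" "M \<subset> K" "M \<subseteq> K" using psubset.prems(1) by (auto simp: \<P>_def)
      interpret AM: associative_algebra rat_field "A M" by (rule algebra[OF MK(1)])
      have "\<exists>e. scalar_mod_ind K e 1 \<and> (\<forall>L\<in>S - {M}. res K L e = \<zero>\<^bsub>A L\<^esub>)"
      proof (rule psubset.IH)
        show "N \<in> S - {M}" if "L \<in> S - {M}" "subgroup N G" "N \<subset> L" for L N
          using psubset.prems(2)[of L N] that max[of L] by blast
      qed (use M psubset.prems in auto)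
      then obtain e where e: "scalar_mod_ind K e 1" "\<forall>L\<in>S - {M}. res K L e = \<zero>\<^bsub>A L\<^esub>" by blast
      obtain R where R: "double_coset_reps G M K M R"
        using double_coset_reps_exist[OF MK(1) MK(1) K MK(3) MK(3)] .
      \<comment> \<open>The number of fixed points of \<open>M\<close> on the cosets of
        \<open>M\<close> in \<open>K\<close>, that is, the index of \<open>M\<close> in its
        normalizer in \<open>K\<close>.\<close>
      define n where "n = card {g \<in> R. M \<subseteq> conjugate G g M}"
      have "R \<subseteq> K" using R by (simp add: double_coset_reps_def)
      then have "R \<subseteq> carrier G" using subgroup.subset[OF K] by (rule subset_trans)
      then have "finite R" using finite_carrier by (rule finite_subset)
      \<comment> \<open>\<open>R\<close> may represent the trivial double coset by an element other
        than the identity, but that representative lies in \<open>M\<close> and is therefore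
        counted. Hence \<open>n\<close> is positive and can be divided by.\<close>
      obtain g l h where g: "g \<in> R" and lh: "l \<in> M" "h \<in> M" "\<one> = l \<otimes> g \<otimes> h"
        using double_coset_repsE[OF R subgroup.one_closed[OF K]] .
      have carr: "l \<in> carrier G" "h \<in> carrier G" "g \<in> carrier G"
        using lh(1,2) g \<open>R \<subseteq> carrier G\<close> subgroup.mem_carrier[OF MK(1)] by auto
      have "inv l \<otimes> inv h = inv l \<otimes> (l \<otimes> g \<otimes> h) \<otimes> inv h"
        using carr by (simp flip: lh(3))
      then have "g = inv l \<otimes> inv h"
        using carr by (simp add: m_assoc inv_mult_mult)
      then have "g \<in> M"
        using lh(1,2) MK(1) by (simp add: subgroup.m_closed subgroup.m_inv_closed)
      then have "conjugate G g M = M" by (rule conjugate_self[OF MK(1)])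
      then have "g \<in> {g \<in> R. M \<subseteq> conjugate G g M}" using g by simp
      then have "n > 0" using \<open>finite R\<close> unfolding n_def card_gt_0_iff by auto
      define b where "b = ind M K \<one>\<^bsub>A M\<^esub>"
      \<comment> \<open>On \<open>M\<close> the element \<open>b\<close> has scalar
        \<open>n\<close>, so this coefficient cancels the identity modulo the ideal. Over
        \<open>K\<close> the added term lies in the ideal and leaves the scalar
        \<open>1\<close>.\<close>
      define r where "r = \<one>\<^bsub>A K\<^esub> \<oplus>\<^bsub>A K\<^esub> (- 1 / of_nat n) \<odot>\<^bsub>A K\<^esub> b"
      have b: "b \<in> proper_ind K" "b \<in> carrier (A K)"
        unfolding b_def using MK K by (auto intro: ind_proper_ind ind_closed)
      then have r1: "scalar_mod_ind K r 1"
        using scalar_mod_ind_add[OF K scalar_mod_ind_one[OF K]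
            scalar_mod_ind_smult[OF K, of b 0 "- 1 / of_nat n"]]
        by (simp add: r_def scalar_mod_ind_zero_iff[OF K])
      have "scalar_mod_ind M (res K M b) (of_nat n)"
        unfolding b_def n_def using res_ind_one_mod_ind[OF MK(1) MK(1) K MK(3,3) R] .
      then have "scalar_mod_ind M (\<one>\<^bsub>A M\<^esub> \<oplus>\<^bsub>A M\<^esub> (- 1 / of_nat n) \<odot>\<^bsub>A M\<^esub> res K M b) 0"
        using scalar_mod_ind_add[OF MK(1) scalar_mod_ind_one[OF MK(1)]
            scalar_mod_ind_smult[OF MK(1), of "res K M b" "of_nat n" "- 1 / of_nat n"]] \<open>n > 0\<close>
        by simp
      then have rM: "res K M r \<in> proper_ind M"
        using b(2) MK K by (simp add: r_def scalar_mod_ind_zero_iff res_add res_one res_smult)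
      have carr': "e \<in> carrier (A K)" "r \<in> carrier (A K)"
        using e(1) r1 scalar_mod_ind_carrier[OF K] by auto
      have "res K M (e \<otimes>\<^bsub>A K\<^esub> r) = res K M e \<otimes>\<^bsub>A M\<^esub> res K M r"
        using MK K carr' by (simp add: res_mult)
      \<comment> \<open>The restriction of \<open>e\<close> to \<open>M\<close> vanishes on all
        proper subgroups of \<open>M\<close>, since these are in \<open>S\<close> and differ from
        \<open>M\<close>. So it annihilates the element \<open>res K M r\<close> of the
        ideal.\<close>
      also have "\<dots> = \<zero>\<^bsub>A M\<^esub>"
      proof (rule mult_proper_ind_eq_zero(2)[OF MK(1) rM])
        show "res K M e \<in> carrier (A M)" using MK K carr' by (simp add: res_closed)
        fix N assume N: "subgroup N G" "N \<subset> M"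
        then have "N \<in> S - {M}" using psubset.prems(2)[OF M] by blast
        with e(2) N MK K carr'(1) show "res M N (res K M e) = \<zero>\<^bsub>A N\<^esub>"
          by (simp add: res_trans psubset_imp_subset)
      qed
      finally have eM: "res K M (e \<otimes>\<^bsub>A K\<^esub> r) = \<zero>\<^bsub>A M\<^esub>" .
      have "res K L (e \<otimes>\<^bsub>A K\<^esub> r) = \<zero>\<^bsub>A L\<^esub>" if "L \<in> S - {M}" for L
      proof -
        have L: "subgroup L G" "L \<subseteq> K" using that psubset.prems(1) by (auto simp: \<P>_def)
        interpret AL: associative_algebra rat_field "A L" by (rule algebra[OF L(1)])
        show ?thesis
          using that e(2) carr' res_closed[OF L(1) K L(2)] by (simp add: res_mult[OF L(1) K L(2)])
      qed
      with eM have "\<forall>L\<in>S. res K L (e \<otimes>\<^bsub>A K\<^esub> r) = \<zero>\<^bsub>A L\<^esub>" by blast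
      with scalar_mod_ind_mult_one[OF K e(1) r1] show ?thesis by blast
    qed
  qed
  from this[OF \<open>finite \<P>\<close>] have "\<exists>e. scalar_mod_ind K e 1 \<and> (\<forall>L\<in>\<P>. res K L e = \<zero>\<^bsub>A L\<^esub>)"
    by (auto simp: \<P>_def)
  then show thesis using that by (auto simp: \<P>_def)
qed

text \<open>Take \<open>e\<close> as above and write it as the identity plus \<open>i\<close> with
  \<open>i\<close> in the ideal. Then \<open>x\<close> times \<open>i\<close> is zero because
  \<open>x\<close> restricts to zero, and \<open>x\<close> times \<open>e\<close> is zero because
  \<open>e\<close> does. Their difference is \<open>x\<close>.\<close>

lemma proper_ind_res_eq_zero_imp_zero:
  assumes K: "subgroup K G" and x: "x \<in> proper_ind K"
    and res_x: "\<And>L. \<lbrakk>subgroup L G; L \<subset> K\<rbrakk> \<Longrightarrow> res K L x = \<zero>\<^bsub>A L\<^esub>"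
  shows "x = \<zero>\<^bsub>A K\<^esub>"
proof -
  interpret AK: associative_algebra rat_field "A K" by (rule algebra[OF K])
  obtain e where e: "scalar_mod_ind K e 1" "\<And>L. \<lbrakk>subgroup L G; L \<subset> K\<rbrakk> \<Longrightarrow> res K L e = \<zero>\<^bsub>A L\<^esub>"
    using exists_one_mod_ind_res_eq_zero[OF K] by blast
  then obtain i where i: "i \<in> proper_ind K" "e = \<one>\<^bsub>A K\<^esub> \<oplus>\<^bsub>A K\<^esub> i"
    using AK.smult_one[of "\<one>\<^bsub>A K\<^esub>"] by (auto simp: scalar_mod_ind_def)
  have carr: "x \<in> carrier (A K)" "e \<in> carrier (A K)" "i \<in> carrier (A K)"
    using x e(1) i(1) K by (auto intro: proper_ind_carrier scalar_mod_ind_carrier)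
  have "x = x \<oplus>\<^bsub>A K\<^esub> x \<otimes>\<^bsub>A K\<^esub> i"
    using mult_proper_ind_eq_zero(2)[OF K i(1) carr(1) res_x] carr by simp
  also have "\<dots> = x \<otimes>\<^bsub>A K\<^esub> e" using carr by (simp add: i(2) AK.M.r_distr)
  also have "\<dots> = \<zero>\<^bsub>A K\<^esub>" using mult_proper_ind_eq_zero(1)[OF K x carr(2) e(2)] .
  finally show ?thesis .
qed

text \<open>The difference \<open>w\<close> of \<open>x\<close> and the identity restricts to zero
  on every subgroup, by induction on the subgroup. Its restriction lies in the ideal, by hypothesis
  at primordial subgroups and because the ideal is everything at the others; the case of
  \<open>carrier G\<close> gives the claim.\<close>

lemma eq_one_if_res_one_mod_ind:
  assumes x: "x \<in> carrier (A (carrier G))"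
    and prim: "\<And>K. primordial G A ind K \<Longrightarrow> scalar_mod_ind K (res (carrier G) K x) 1"
  shows "x = \<one>\<^bsub>A (carrier G)\<^esub>"
proof -
  interpret AG: associative_algebra rat_field "A (carrier G)" by (rule algebra[OF subgroup_self])
  define w where "w = x \<oplus>\<^bsub>A (carrier G)\<^esub> (- 1) \<odot>\<^bsub>A (carrier G)\<^esub> \<one>\<^bsub>A (carrier G)\<^esub>"
  have w: "w \<in> carrier (A (carrier G))" using x by (simp add: w_def)
  have "res (carrier G) K w = \<zero>\<^bsub>A K\<^esub>" if "subgroup K G" for K
    using finite_subset[OF subgroup.subset[OF that] finite_carrier] that
  proof (induction K rule: finite_psubset_induct)
    case (psubset K)
    then have K: "subgroup K G" "K \<subseteq> carrier G" by (auto dest: subgroup.subset)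
    note resK = res_closed[OF K(1) subgroup_self K(2)] res_add[OF K(1) subgroup_self K(2)]
      res_smult[OF K(1) subgroup_self K(2)] res_one[OF K(1) subgroup_self K(2)]
    have "res (carrier G) K w \<in> proper_ind K"
    proof (cases "primordial G A ind K")
      case True
      have "scalar_mod_ind K (res (carrier G) K x \<oplus>\<^bsub>A K\<^esub> (- 1) \<odot>\<^bsub>A K\<^esub> \<one>\<^bsub>A K\<^esub>) (1 + - 1 * 1)"
        using prim[OF True] scalar_mod_ind_one[OF K(1)] K(1)
        by (intro scalar_mod_ind_add scalar_mod_ind_smult)
      then show ?thesis
        using x by (simp add: w_def resK scalar_mod_ind_zero_iff[OF K(1)])
    next
      case False
      then show ?thesis
        using carrier_eq_proper_ind_if_not_primordial[OF K(1)] resK(1)[OF w] by simp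
    qed
    then show ?case
    proof (rule proper_ind_res_eq_zero_imp_zero[OF K(1)])
      fix L assume L: "subgroup L G" "L \<subset> K"
      then show "res K L (res (carrier G) K w) = \<zero>\<^bsub>A L\<^esub>"
        using psubset.IH[of L] w K by (simp add: res_trans subgroup_self psubset_imp_subset)
    qed
  qed
  from this[OF subgroup_self] have "w = \<zero>\<^bsub>A (carrier G)\<^esub>"
    using w by (simp add: res_id subgroup_self)
  \<comment> \<open>The difference \<open>w\<close> uses the scalar \<open>- 1\<close> so that
    linearity of restriction applies to it; here this scalar multiple becomes the additive
    inverse.\<close>
  moreover have "(- 1) \<odot>\<^bsub>A (carrier G)\<^esub> \<one>\<^bsub>A (carrier G)\<^esub> = \<ominus>\<^bsub>A (carrier G)\<^esub> \<one>\<^bsub>A (carrier G)\<^esub>"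
  proof (rule AG.M.minus_equality[symmetric])
    show "(- 1) \<odot>\<^bsub>A (carrier G)\<^esub> \<one>\<^bsub>A (carrier G)\<^esub> \<oplus>\<^bsub>A (carrier G)\<^esub> \<one>\<^bsub>A (carrier G)\<^esub> = \<zero>\<^bsub>A (carrier G)\<^esub>"
      using AG.smult_l_distr[of "- 1" 1 "\<one>\<^bsub>A (carrier G)\<^esub>"] AG.smult_one[of "\<one>\<^bsub>A (carrier G)\<^esub>"]
        AG.smult_l_null[of "\<one>\<^bsub>A (carrier G)\<^esub>"] by simp
  qed auto
  ultimately show ?thesis
    using x by (metis AG.M.one_closed AG.M.minus_minus AG.M.minus_equality AG.M.a_inv_closed w_def)
qed

end

section \<open>Scalars of the right-hand side at primordial subgroups\<close>

theorem theorem3p5: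
  fixes G :: "('g, 'm) monoid_scheme"
    and A :: "'g set \<Rightarrow> (rat, 'a) module"
    and res ind :: "'g set \<Rightarrow> 'g set \<Rightarrow> 'a \<Rightarrow> 'a"
    and cj :: "'g \<Rightarrow> 'g set \<Rightarrow> 'a \<Rightarrow> 'a"
    and \<C> :: "'g set set"
  assumes "group G" and "finite (carrier G)"
    and "rational_green_functor G A res ind cj"
    and "\<And>H. H \<in> \<C> \<Longrightarrow> subgroup H G"
    and "\<And>H g. \<lbrakk>H \<in> \<C>; g \<in> carrier G\<rbrakk> \<Longrightarrow> conjugate G g H \<in> \<C>"
    and "\<And>K. primordial G A ind K \<Longrightarrow> centralizer G K \<in> \<C>"
  shows "\<one>\<^bsub>A (carrier G)\<^esub> =
    (\<Oplus>\<^bsub>A (carrier G)\<^esub>H\<in>\<C>.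
      (- of_int (reduced_euler_characteristic {K \<in> \<C>. K \<subset> H})
        / of_nat (card (rcosets\<^bsub>G\<^esub> (centralizer G H))))
      \<odot>\<^bsub>A (carrier G)\<^esub> ind (centralizer G H) (carrier G) \<one>\<^bsub>A (centralizer G H)\<^esub>)"
proof -
  interpret rational_green_functor G A res ind cj by fact
  interpret AG: associative_algebra rat_field "A (carrier G)" by (rule algebra[OF subgroup_self])
  have \<C>_sub: "H \<subseteq> carrier G" if "H \<in> \<C>" for H
    using assms(4)[OF that] by (rule subgroup.subset)
  then have "finite \<C>"
    using assms(2) by (intro finite_subset[of \<C> "Pow (carrier G)"]) auto
  define f :: "'g set \<Rightarrow> rat" where "f H = - of_int (reduced_euler_characteristic {K \<in> \<C>. K \<subset> H})" for H
  define C where "C H = centralizer G H" for H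
  define t where "t H = (f H / of_nat (card (rcosets\<^bsub>G\<^esub> C H))) \<odot>\<^bsub>A (carrier G)\<^esub> ind (C H) (carrier G) \<one>\<^bsub>A (C H)\<^esub>" for H
  have C: "subgroup (C H) G" "C H \<subseteq> carrier G" if "H \<in> \<C>" for H
    using \<C>_sub[OF that] by (auto simp: C_def subgroup_centralizer centralizer_subset)
  have ind: "ind (C H) (carrier G) \<one>\<^bsub>A (C H)\<^esub> \<in> carrier (A (carrier G))" if "H \<in> \<C>" for H
    using ind_closed[OF C(1)[OF that] subgroup_self C(2)[OF that]]
      ring.ring_simprules(6)[OF A_ring[OF C(1)[OF that]]] by simp
  then have t: "t H \<in> carrier (A (carrier G))" if "H \<in> \<C>" for H
    using that by (simp add: t_def)
  have "(\<Oplus>\<^bsub>A (carrier G)\<^esub>H\<in>\<C>. t H) = \<one>\<^bsub>A (carrier G)\<^esub>"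
  proof (rule eq_one_if_res_one_mod_ind)
    show "(\<Oplus>\<^bsub>A (carrier G)\<^esub>H\<in>\<C>. t H) \<in> carrier (A (carrier G))"
      using t by (simp add: AG.M.finsum_closed Pi_iff)
    fix K assume K_prim: "primordial G A ind K"
    then have K: "subgroup K G" by (simp add: primordial_def)
    have K_sub: "K \<subseteq> carrier G" using K by (rule subgroup.subset)
    \<comment> \<open>Counting elements of \<open>G\<close> instead of coset representatives
      replaces division by the index by division by the order of \<open>G\<close>. The denominator
      no longer depends on \<open>H\<close>, and the sum over \<open>\<C>\<close> can be double
      counted.\<close>
    have term_mod: "scalar_mod_ind K (res (carrier G) K (t H))
        (f H * of_nat (card {g \<in> carrier G. conjugate G g H \<subseteq> C K}) / of_nat (card (carrier G)))"
      if H: "H \<in> \<C>" for H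
    proof -
      obtain R where R: "double_coset_reps G K (carrier G) (C H) R"
        using double_coset_reps_exist[OF K C(1)[OF H] subgroup_self K_sub C(2)[OF H]] .
      have "K \<subseteq> conjugate G g (C H) \<longleftrightarrow> conjugate G g H \<subseteq> C K" if "g \<in> carrier G" for g
        unfolding C_def conjugate_centralizer[OF that \<C>_sub[OF H]]
        by (rule subset_centralizer_iff[OF conjugate_subset_carrier[OF that \<C>_sub[OF H]] K_sub])
      then have "{g \<in> carrier G. conjugate G g H \<subseteq> C K} = {g \<in> carrier G. K \<subseteq> conjugate G g (C H)}"
        by blast
      then have fixed: "card {g \<in> carrier G. conjugate G g H \<subseteq> C K}
          = card {g \<in> R. K \<subseteq> conjugate G g (C H)} * card (C H)"
        using card_fixed_points[OF C(1)[OF H] K R] by simp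
      have "card (C H) > 0"
        using C[OF H] assms(2) subgroup.one_closed finite_subset by (fastforce simp: card_gt_0_iff)
      then have val: "f H / of_nat (card (rcosets\<^bsub>G\<^esub> C H)) * of_nat (card {g \<in> R. K \<subseteq> conjugate G g (C H)})
          = f H * of_nat (card {g \<in> carrier G. conjugate G g H \<subseteq> C K}) / of_nat (card (carrier G))"
        unfolding fixed lagrange[OF C(1)[OF H], unfolded Coset.order_def, symmetric] by simp
      have res_t: "res (carrier G) K (t H) = (f H / of_nat (card (rcosets\<^bsub>G\<^esub> C H))) \<odot>\<^bsub>A K\<^esub>
          res (carrier G) K (ind (C H) (carrier G) \<one>\<^bsub>A (C H)\<^esub>)"
        unfolding t_def by (rule res_smult[OF K subgroup_self K_sub ind[OF H]])
      show ?thesis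
        unfolding res_t val[symmetric]
        by (rule scalar_mod_ind_smult[OF K res_ind_one_mod_ind[OF K C(1)[OF H] subgroup_self C(2)[OF H] K_sub R]])
    qed
    \<comment> \<open>The hypothesis on centralizers enters here: it makes \<open>C K\<close> the
      largest element of the poset of members of \<open>\<C>\<close> contained in
      \<open>C K\<close>.\<close>
    have "C K \<in> \<C>" unfolding C_def using assms(6)[OF K_prim] .
    have "(\<Sum>H\<in>\<C>. f H * of_nat (card {g \<in> carrier G. conjugate G g H \<subseteq> C K}))
        = of_nat (card (carrier G)) * (\<Sum>H | H \<in> \<C> \<and> H \<subseteq> C K. f H)"
      using assms(2) \<open>finite \<C>\<close> \<C>_sub assms(5)
    proof (rule sum_card_conjugate)
      show "f (conjugate G g H) = f H" if "H \<in> \<C>" "g \<in> carrier G" for H g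
        unfolding f_def using reduced_euler_characteristic_conjugate[OF that(2) \<C>_sub that(1) assms(5)] by simp
    qed
    also have "(\<Sum>H | H \<in> \<C> \<and> H \<subseteq> C K. f H)
        = of_int (\<Sum>H\<in>{H \<in> \<C>. H \<subseteq> C K}. - reduced_euler_characteristic {L \<in> {H \<in> \<C>. H \<subseteq> C K}. L < H})"
      unfolding of_int_sum
    proof (rule sum.cong)
      \<comment> \<open>Everything below such an \<open>H\<close> already lies in
        \<open>C K\<close>, so passing to the smaller poset leaves the coefficient of
        \<open>H\<close> unchanged.\<close>
      fix H assume "H \<in> {H \<in> \<C>. H \<subseteq> C K}"
      then have "{L \<in> \<C>. L \<subset> H} = {L \<in> {H \<in> \<C>. H \<subseteq> C K}. L < H}" by auto
      then show "f H = of_int (- reduced_euler_characteristic {L \<in> {H \<in> \<C>. H \<subseteq> C K}. L < H})"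
        by (simp add: f_def)
    qed simp
    also have "\<dots> = 1"
      using \<open>finite \<C>\<close> \<open>C K \<in> \<C>\<close>
      by (subst sum_reduced_euler_characteristic_top[where m = "C K"]) auto
    finally have "(\<Sum>H\<in>\<C>. f H * of_nat (card {g \<in> carrier G. conjugate G g H \<subseteq> C K}) / of_nat (card (carrier G))) = 1"
      using assms(2) one_closed by (force simp flip: sum_divide_distrib)
    then show "scalar_mod_ind K (res (carrier G) K (\<Oplus>\<^bsub>A (carrier G)\<^esub>H\<in>\<C>. t H)) 1"
      using scalar_mod_ind_finsum[OF K \<open>finite \<C>\<close> term_mod, of "\<lambda>H. H"]
        res_finsum[OF K subgroup_self K_sub \<open>finite \<C>\<close> t, of "\<lambda>H. H"] by simp
  qed
  then show ?thesis by (simp add: t_def f_def C_def)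
qed

end
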